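(* Let $s=q_1,\ldots,q_n$ be a non-leaping sequence. Let $G_0$ be a connected graph with an edge $e=\{v_1,v_2\}$. Then for $G\in\mathrm{CP}(s)$, the determinant $\det(\mathcal{D}(G_0\oplus_e G))$ is independent of the choice of $G\in\mathrm{CP}(s)$.
   Context: A sequence of integers $q_1,\ldots,q_n$ ($n\ge 2$) is non-leaping if $q_1=0$, $q_2=1$, and $2\le q_k\le q_{k-1}+1$ for $k=3,\ldots,n$. Set $b_k=k-q_k+1$ for $k\ge 3$. A neighborhood sequence of $s$ is a sequence of sets $W_1=\varnothing$, $W_2=\{1\}$, and for $k\ge3$, $W_k=\{a_k\}\cup\{b_k,\ldots,k-1\}$ where $a_k\in W_{k-1}$ and $a_k<b_k$. Its graph has vertex set $\{1,\ldots,n\}$ with vertex $k$ joined to every vertex of $W_k$. $\mathrm{CP}(s)$ is the family of graphs of all neighborhood sequences of $s$. For a connected graph $G_0$ with edge $e=\{v_1,v_2\}$ and $G\in\mathrm{CP}(s)$, $G_0\oplus_e G$ is the graph obtained from the disjoint union of $G_0$ and $G$ by identifying $v_1$ with vertex $1$ and $v_2$ with vertex $2$ (so the edges $\{v_1,v_2\}$ and $\{1,2\}$ are identified). $\mathcal{D}(\cdot)$ denotes the distance matrix. *)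

theory Defs
  imports "Graph_Theory.Graph_Theory" "Jordan_Normal_Form.Determinant"
begin

text \<open>
  An undirected simple graph is a finite symmetric loop-free digraph (locale
  \<^locale>\<open>pair_graph\<close>): an edge \<open>{u, v}\<close> is the pair of arcs \<open>(u, v)\<close>, \<open>(v, u)\<close>.
  A sequence \<open>q\<^sub>1, \<dots>, q\<^sub>n\<close> is a function together with its length \<open>n\<close>; values outside
  \<open>{1..n}\<close> are irrelevant. The same holds for sequences of sets.
\<close>

definition non_leaping :: "nat \<Rightarrow> (nat \<Rightarrow> int) \<Rightarrow> bool" where
  "non_leaping n q \<longleftrightarrow> n \<ge> 2 \<and> q 1 = 0 \<and> q 2 = 1 \<and>
     (\<forall>k\<in>{3..n}. 2 \<le> q k \<and> q k \<le> q (k - 1) + 1)"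

definition nbhd_start :: "(nat \<Rightarrow> int) \<Rightarrow> nat \<Rightarrow> int" where
  "nbhd_start q k = int k - q k + 1"

definition nbhd_seq :: "nat \<Rightarrow> (nat \<Rightarrow> int) \<Rightarrow> (nat \<Rightarrow> nat set) \<Rightarrow> bool" where
  "nbhd_seq n q W \<longleftrightarrow> W 1 = {} \<and> W 2 = {1} \<and>
     (\<forall>k\<in>{3..n}. \<exists>a \<in> W (k - 1). int a < nbhd_start q k \<and>
        W k = {a} \<union> {j. nbhd_start q k \<le> int j \<and> j \<le> k - 1})"

definition nbhd_graph :: "nat \<Rightarrow> (nat \<Rightarrow> nat set) \<Rightarrow> nat pair_pre_digraph" where
  "nbhd_graph n W =
     \<lparr> pverts = {1..n},
       parcs = (\<Union>k\<in>{1..n}. \<Union>j\<in>W k. {(k, j), (j, k)}) \<rparr>"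

definition CP :: "nat \<Rightarrow> (nat \<Rightarrow> int) \<Rightarrow> nat pair_pre_digraph set" where
  "CP n q = {nbhd_graph n W |W. nbhd_seq n q W}"

text \<open>
  In the gluing of \<open>G0\<close> and \<open>G\<close> along the edge \<open>{v1, v2}\<close>, the class of the identified
  vertices \<open>v1\<close> and \<open>1\<close> is represented by \<open>Inl v1\<close>, that of \<open>v2\<close> and \<open>2\<close> by \<open>Inl v2\<close>.
\<close>

definition glue_vertex :: "'a \<Rightarrow> 'a \<Rightarrow> nat \<Rightarrow> 'a + nat" where
  "glue_vertex v1 v2 k = (if k = 1 then Inl v1 else if k = 2 then Inl v2 else Inr k)"

definition edge_glue ::
  "'a pair_pre_digraph \<Rightarrow> 'a \<Rightarrow> 'a \<Rightarrow> nat pair_pre_digraph \<Rightarrow> ('a + nat) pair_pre_digraph" where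
  "edge_glue G0 v1 v2 G =
     \<lparr> pverts = Inl ` pverts G0 \<union> glue_vertex v1 v2 ` pverts G,
       parcs = map_prod Inl Inl ` parcs G0 \<union>
         map_prod (glue_vertex v1 v2) (glue_vertex v1 v2) ` parcs G \<rparr>"

definition graph_dist :: "'a pair_pre_digraph \<Rightarrow> 'a \<Rightarrow> 'a \<Rightarrow> real" where
  "graph_dist G u v = real_of_ereal (wf_digraph.\<mu> (with_proj G) (\<lambda>_. 1) u v)"

definition vertex_ordering :: "'a pair_pre_digraph \<Rightarrow> 'a list \<Rightarrow> bool" where
  "vertex_ordering G vs \<longleftrightarrow> distinct vs \<and> set vs = pverts G"

text \<open>The list \<open>vs\<close> is the ordering of the vertices by which rows and columns are indexed.\<close>

definition distance_matrix :: "'a pair_pre_digraph \<Rightarrow> 'a list \<Rightarrow> real mat" where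
  "distance_matrix G vs =
     mat (length vs) (length vs) (\<lambda>(i, j). graph_dist G (vs ! i) (vs ! j))"

end

theory Submission
  imports Defs
begin

text \<open>
  Order the vertices of the glued graph as those of \<open>G\<^sub>0\<close> followed by \<open>3, \<dots>, n\<close>. Each \<open>k \<ge> 3\<close> is
  attached to the clique \<open>W\<^sub>k\<close> of earlier vertices, hence \<open>d(k, v) = 1 + min {d(w, v) | w \<in> W\<^sub>k}\<close> for
  earlier \<open>v\<close>. This gives \<open>d(k, v) - d(a\<^sub>k, v) = 1\<close> for earlier \<open>v\<close>, except that it is \<open>0\<close> for
  \<open>v \<in> {b\<^sub>k, \<dots>, k - 1}\<close>, and except for \<open>v\<close> in \<open>G\<^sub>0\<close> when \<open>b\<^sub>k = 2\<close>, where \<open>a\<^sub>k = 1\<close> is forced.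
  Subtract the row and the column of \<open>a\<^sub>k\<close> from those of \<open>k\<close>, for all \<open>k \<ge> 3\<close> at once: this is a
  congruence by a unitriangular matrix. Since \<open>a\<^sub>j < b\<^sub>j \<le> b\<^sub>k\<close> for \<open>j < k\<close>, the \<open>(k, j)\<close> entry becomes
  \<open>-1\<close> if \<open>j \<ge> b\<^sub>k\<close> and \<open>0\<close> otherwise, the \<open>(k, k)\<close> entry becomes \<open>-2\<close>, and nothing depends on the
  \<open>a\<^sub>k\<close> any more.
\<close>

section \<open>Determinants\<close>

text \<open>The new matrix is \<open>P * A\<close>, where \<open>P\<close> is lower unitriangular
  because \<open>p i < i\<close>. All subtractions use the original rows of \<open>A\<close>, so
  they happen simultaneously.\<close>

lemma det_subtract_previous_rows:
  fixes A :: "real mat"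
  assumes A: "A \<in> carrier_mat N N" and p: "\<And>i. i < N \<Longrightarrow> i \<in> I \<Longrightarrow> p i < i"
  shows "det (mat N N (\<lambda>(i, j). A $$ (i, j) - (if i \<in> I then A $$ (p i, j) else 0))) = det A"
    (is "det ?B = _")
proof -
  define P :: "real mat" where
    "P = mat N N (\<lambda>(i, j). (if j = i then 1 else 0) - (if i \<in> I \<and> j = p i then 1 else 0))"
  have P: "P \<in> carrier_mat N N" by (simp add: P_def)
  have "?B = P * A"
  proof (rule eq_matI)
    fix i j assume "i < dim_row (P * A)" "j < dim_col (P * A)"
    then have ij: "i < N" "j < N" using P A by auto
    have "(P * A) $$ (i, j) =
      (\<Sum>k<N. ((if k = i then 1 else 0) - (if i \<in> I \<and> k = p i then 1 else 0)) * A $$ (k, j))"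
      using ij A P by (simp add: P_def scalar_prod_def lessThan_atLeast0)
    also have "\<dots> = (\<Sum>k<N. (if k = i then A $$ (k, j) else 0)) -
        (\<Sum>k<N. (if k = p i then (if i \<in> I then A $$ (k, j) else 0) else 0))"
      unfolding sum_subtractf[symmetric] by (intro sum.cong) auto
    also have "\<dots> = A $$ (i, j) - (if i \<in> I then A $$ (p i, j) else 0)"
      using ij p[of i] by (cases "i \<in> I") auto
    finally show "?B $$ (i, j) = (P * A) $$ (i, j)" using ij by simp
  qed (use P A in auto)
  moreover have "det P = 1"
  proof -
    have "P $$ (i, j) = 0" if "i < j" "j < N" for i j
      using that p[of i] by (auto simp: P_def)
    then have "det P = prod_list (diag_mat P)" by (rule det_lower_triangular[OF _ P])
    also have "\<dots> = 1"
      unfolding prod_list_diag_prod using P p by (intro prod.neutral) (fastforce simp: P_def)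
    finally show ?thesis .
  qed
  ultimately show ?thesis using det_mult[OF P A] by simp
qed

text \<open>Row subtraction is applied to the matrix and then to the transpose of the result;
  \<open>\<pi>\<close> translates the label \<open>p u\<close> into an earlier index.\<close>

lemma det_subtract_previous_rows_cols:
  fixes f :: "'b \<Rightarrow> 'b \<Rightarrow> real"
  assumes par: "\<And>i. i < length us \<Longrightarrow> us ! i \<in> I \<Longrightarrow> \<exists>j<i. us ! j = p (us ! i)"
  shows "det (mat (length us) (length us) (\<lambda>(i, j). f (us ! i) (us ! j))) =
    det (mat (length us) (length us) (\<lambda>(i, j).
      (f (us ! i) (us ! j) - (if us ! i \<in> I then f (p (us ! i)) (us ! j) else 0)) -
      (if us ! j \<in> I then
        f (us ! i) (p (us ! j)) - (if us ! i \<in> I then f (p (us ! i)) (p (us ! j)) else 0)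
       else 0)))"
proof -
  let ?N = "length us"
  define J where "J = {i. i < ?N \<and> us ! i \<in> I}"
  have "\<forall>i\<in>J. \<exists>j<i. us ! j = p (us ! i)" using par by (auto simp: J_def)
  then obtain \<pi> where \<pi>: "\<And>i. i \<in> J \<Longrightarrow> \<pi> i < i" "\<And>i. i \<in> J \<Longrightarrow> us ! \<pi> i = p (us ! i)"
    by metis
  define A where "A = mat ?N ?N (\<lambda>(i, j). f (us ! i) (us ! j))"
  define B where "B = mat ?N ?N (\<lambda>(i, j). A $$ (i, j) - (if i \<in> J then A $$ (\<pi> i, j) else 0))"
  define C where "C = mat ?N ?N
    (\<lambda>(i, j). transpose_mat B $$ (i, j) - (if i \<in> J then transpose_mat B $$ (\<pi> i, j) else 0))"
  have carrier: "A \<in> carrier_mat ?N ?N" "B \<in> carrier_mat ?N ?N" "C \<in> carrier_mat ?N ?N"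
    by (auto simp: A_def B_def C_def)
  have "det A = det B"
    unfolding B_def by (rule det_subtract_previous_rows[symmetric]) (use carrier \<pi> in auto)
  also have "\<dots> = det (transpose_mat B)" using carrier by (simp add: det_transpose)
  also have "\<dots> = det C"
    unfolding C_def by (rule det_subtract_previous_rows[symmetric]) (use carrier \<pi> in auto)
  also have "\<dots> = det (transpose_mat C)" using carrier by (simp add: det_transpose)
  also have "transpose_mat C = mat ?N ?N (\<lambda>(i, j).
      (f (us ! i) (us ! j) - (if us ! i \<in> I then f (p (us ! i)) (us ! j) else 0)) -
      (if us ! j \<in> I then
        f (us ! i) (p (us ! j)) - (if us ! i \<in> I then f (p (us ! i)) (p (us ! j)) else 0)
       else 0))"
  proof -
    have lt: "\<pi> i < ?N" if "i \<in> J" for i using \<pi>(1)[OF that] that by (simp add: J_def)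
    have J: "i \<in> J \<longleftrightarrow> us ! i \<in> I" if "i < ?N" for i using that by (simp add: J_def)
    show ?thesis
      by (rule eq_matI) (auto simp: C_def B_def A_def lt \<pi>(2) J)
  qed
  finally show ?thesis by (simp add: A_def)
qed

text \<open>One permutation acts on rows and columns alike, so its sign enters twice. This removes
  the dependence on the vertex ordering.\<close>

lemma det_reindex:
  fixes f :: "'b \<Rightarrow> 'b \<Rightarrow> real"
  assumes vs: "distinct vs" and us: "distinct us" and set_eq: "set vs = set us"
  shows "det (mat (length vs) (length vs) (\<lambda>(i, j). f (vs ! i) (vs ! j))) =
    det (mat (length us) (length us) (\<lambda>(i, j). f (us ! i) (us ! j)))"
proof -
  let ?N = "length us"
  have len: "length vs = ?N" using assms by (metis distinct_card)
  have "mset vs = mset us" using assms by (simp add: set_eq_iff_mset_eq_distinct)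
  then obtain s where s: "s permutes {..<?N}" "permute_list s us = vs"
    by (rule mset_eq_permutation)
  have s: "s permutes {0..<?N}" and vs_nth: "\<And>i. i < ?N \<Longrightarrow> vs ! i = us ! s i"
    using s by (auto simp: lessThan_atLeast0 permute_list_nth)
  define A where "A = mat ?N ?N (\<lambda>(i, j). f (us ! i) (us ! j))"
  define B where "B = mat ?N ?N (\<lambda>(i, j). A $$ (s i, j))"
  define C where "C = mat ?N ?N (\<lambda>(i, j). transpose_mat B $$ (s i, j))"
  have carrier: "A \<in> carrier_mat ?N ?N" "B \<in> carrier_mat ?N ?N" "C \<in> carrier_mat ?N ?N"
    by (auto simp: A_def B_def C_def)
  have lt: "s i < ?N" if "i < ?N" for i using permutes_in_image[OF s, of i] that by simp
  have "transpose_mat C = mat ?N ?N (\<lambda>(i, j). f (vs ! i) (vs ! j))"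
    by (rule eq_matI) (auto simp: C_def B_def A_def lt vs_nth)
  then have "det (mat ?N ?N (\<lambda>(i, j). f (vs ! i) (vs ! j))) = det C"
    using carrier det_transpose[of C ?N] by simp
  also have "\<dots> = signof s * (signof s * det A)"
    unfolding C_def using det_permute_rows[OF _ s, of "transpose_mat B"] carrier
      det_permute_rows[OF carrier(1) s, folded B_def] by (simp add: det_transpose)
  also have "\<dots> = det A" by (simp add: sign_def)
  finally show ?thesis by (simp add: len A_def)
qed

section \<open>Distances by unit steps\<close>

lemma Min_image_witness:
  assumes "finite A" "A \<noteq> {}"
  obtains w where "w \<in> A" "Min (f ` A) = f w"
proof -
  have "Min (f ` A) \<in> f ` A" using assms by (intro Min_in) auto
  then show thesis using that by blast
qed

text \<open>Local conditions that pin down the graph distance. Unlike an infimum over walks, they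
  can be verified directly when a vertex is added.\<close>

definition hop_metric :: "'b set \<Rightarrow> ('b \<times> 'b) set \<Rightarrow> ('b \<Rightarrow> 'b \<Rightarrow> nat) \<Rightarrow> bool" where
  "hop_metric V E d \<longleftrightarrow>
     (\<forall>u\<in>V. d u u = 0) \<and>
     (\<forall>u\<in>V. \<forall>v w. (v, w) \<in> E \<longrightarrow> d u w \<le> Suc (d u v)) \<and>
     (\<forall>u\<in>V. \<forall>v\<in>V. v \<noteq> u \<longrightarrow> (\<exists>w\<in>V. (w, v) \<in> E \<and> d u v = Suc (d u w))) \<and>
     (\<forall>u\<in>V. \<forall>v\<in>V. d u v = d v u)"

lemma hop_metricD:
  assumes "hop_metric V E d"
  shows hop_metric_self: "u \<in> V \<Longrightarrow> d u u = 0"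
    and hop_metric_arc: "u \<in> V \<Longrightarrow> (v, w) \<in> E \<Longrightarrow> d u w \<le> Suc (d u v)"
    and hop_metric_pred:
      "u \<in> V \<Longrightarrow> v \<in> V \<Longrightarrow> v \<noteq> u \<Longrightarrow> \<exists>w\<in>V. (w, v) \<in> E \<and> d u v = Suc (d u w)"
    and hop_metric_sym: "u \<in> V \<Longrightarrow> v \<in> V \<Longrightarrow> d u v = d v u"
  using assms unfolding hop_metric_def by blast+

lemma hop_metric_adjacent:
  assumes "hop_metric V E d" "(u, v) \<in> E" "u \<in> V" "v \<in> V" "u \<noteq> v"
  shows "d u v = 1"
  using hop_metric_arc[OF assms(1,3,2)] hop_metric_self[OF assms(1,3)]
    hop_metric_pred[OF assms(1,3,4)] assms(5) by fastforce

text \<open>The arc condition bounds the length of every walk from below; following predecessors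
  back to \<open>u\<close> yields a walk of length \<open>d u v\<close>.\<close>

lemma graph_dist_hop_metric:
  assumes wf: "pair_wf_digraph G" and d: "hop_metric (pverts G) (parcs G) d"
    and u: "u \<in> pverts G" and v: "v \<in> pverts G"
  shows "graph_dist G u v = real (d u v)"
proof -
  interpret pair_wf_digraph G by (rule wf)
  have lower: "d u w \<le> d u x + length p" if "awalk x p w" for x p w
    using that
  proof (induction p arbitrary: x)
    case Nil
    then show ?case by (simp add: awalk_Nil_iff)
  next
    case (Cons e p)
    then have "(x, snd e) \<in> parcs G" and walk: "awalk (snd e) p w"
      by (auto simp: awalk_Cons_iff)
    then have "d u (snd e) \<le> Suc (d u x)" using hop_metric_arc[OF d u] by blast
    with Cons.IH[OF walk] show ?case by simp
  qed
  have upper: "\<exists>p. awalk u p x \<and> length p = k" if "x \<in> pverts G" "d u x = k" for x k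
    using that
  proof (induction k arbitrary: x)
    case 0
    then have "x = u" using hop_metric_pred[OF d u, of x] by force
    then show ?case using u by (auto simp: awalk_Nil_iff)
  next
    case (Suc k)
    then have "x \<noteq> u" using hop_metric_self[OF d u] by auto
    then obtain w where w: "w \<in> pverts G" "(w, x) \<in> parcs G" "d u x = Suc (d u w)"
      using hop_metric_pred[OF d u Suc.prems(1)] by blast
    then obtain p where p: "awalk u p w" "length p = k" using Suc by fastforce
    have "awalk w [(w, x)] x" using w Suc.prems(1) by (simp add: awalk_Cons_iff awalk_Nil_iff)
    then have "awalk u (p @ [(w, x)]) x" using p(1) by (simp add: awalk_append_iff)
    with p(2) show ?case by (metis length_append_singleton)
  qed
  have cost: "awalk_cost (\<lambda>_. 1) p = real (length p)" for p
    by (induction p) auto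
  have "\<mu> (\<lambda>_. 1) u v = ereal (real (d u v))"
  proof (rule antisym)
    obtain p where "awalk u p v" "length p = d u v" using upper[OF v] by blast
    then show "\<mu> (\<lambda>_. 1) u v \<le> ereal (real (d u v))"
      unfolding \<mu>_def by (metis (mono_tags, lifting) INF_lower2 cost mem_Collect_eq order_refl)
    show "ereal (real (d u v)) \<le> \<mu> (\<lambda>_. 1) u v"
      unfolding \<mu>_def using lower[of u _ v] hop_metric_self[OF d u]
      by (intro INF_greatest) (auto simp: cost)
  qed
  then show ?thesis by (simp add: graph_dist_def)
qed

text \<open>Symmetry of the arcs turns connectedness into strong connectedness, so any two vertices
  are related by some power of the arc relation; the least exponent serves as distance.\<close>

lemma connected_graph_hop_metric:
  assumes G: "pair_graph G" and conn: "Digraph_Component.connected (with_proj G)"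
  obtains d where "hop_metric (pverts G) (parcs G) d"
proof -
  interpret pair_graph G by (rule G)
  let ?E = "parcs G"
  define d where "d u v = (LEAST k. (u, v) \<in> ?E ^^ k)" for u v
  have sym: "sym ?E" using pair_sym_arcs by (simp add: symmetric_def)
  have "strongly_connected (with_proj G)"
    by (rule symmetric_connected_imp_strongly_connected) (use pair_sym_arcs conn in auto)
  then have "(u, v) \<in> ?E\<^sup>*" if "u \<in> pverts G" "v \<in> pverts G" for u v
    using that reachable_rtranclI[of "with_proj G" u v] by (auto simp: strongly_connected_def)
  then have ex: "(u, v) \<in> ?E ^^ d u v" if "u \<in> pverts G" "v \<in> pverts G" for u v
    unfolding d_def using that by (meson LeastI rtrancl_imp_relpow)
  have le: "d u v \<le> k" if "(u, v) \<in> ?E ^^ k" for u v k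
    unfolding d_def using that by (rule Least_le)
  have flip: "(v, u) \<in> ?E ^^ k" if "(u, v) \<in> ?E ^^ k" for u v k
    using that
  proof (induction k arbitrary: v)
    case (Suc k)
    then obtain w where "(u, w) \<in> ?E ^^ k" "(w, v) \<in> ?E" by auto
    then show ?case using Suc.IH sym by (meson relpow_Suc_I2 symD)
  qed simp
  have "hop_metric (pverts G) ?E d"
    unfolding hop_metric_def
  proof (intro conjI ballI allI impI)
    fix u assume u: "u \<in> pverts G"
    show "d u u = 0" using le[of u u 0] by simp
    fix v w assume vw: "(v, w) \<in> ?E"
    then have "(u, w) \<in> ?E ^^ Suc (d u v)"
      using ex[OF u] in_arcsD1 by auto
    then show "d u w \<le> Suc (d u v)" by (rule le)
  next
    fix u v assume u: "u \<in> pverts G" and v: "v \<in> pverts G" and "v \<noteq> u"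
    obtain k where k: "d u v = Suc k"
      using ex[OF u v] \<open>v \<noteq> u\<close> by (cases "d u v") auto
    then obtain w where w: "(u, w) \<in> ?E ^^ k" "(w, v) \<in> ?E" using ex[OF u v] by auto
    have wV: "w \<in> pverts G" using w(2) in_arcsD1 by auto
    have "(u, v) \<in> ?E ^^ Suc (d u w)" using ex[OF u wV] w(2) by auto
    then have "d u v = Suc (d u w)" using le[OF w(1)] le[of u v "Suc (d u w)"] k by linarith
    with w(2) wV show "\<exists>w\<in>pverts G. (w, v) \<in> ?E \<and> d u v = Suc (d u w)" by blast
  next
    fix u v assume "u \<in> pverts G" "v \<in> pverts G"
    then show "d u v = d v u" using ex flip le by (meson antisym)
  qed
  then show thesis by (rule that)
qed

text \<open>Distances from members of the clique \<open>C\<close> to a fixed vertex differ by at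
  most one, so a detour through \<open>x\<close> never shortens a path between old vertices:
  \<open>d\<close> survives on \<open>V\<close>, and \<open>x\<close> lies one step behind the
  nearest member of \<open>C\<close>.\<close>

lemma hop_metric_add_simplicial:
  fixes d :: "'b \<Rightarrow> 'b \<Rightarrow> nat"
  assumes d: "hop_metric V E d" and E: "E \<subseteq> V \<times> V" and x: "x \<notin> V"
    and C: "C \<subseteq> V" "finite C" "C \<noteq> {}"
    and clique: "\<And>a b. a \<in> C \<Longrightarrow> b \<in> C \<Longrightarrow> a \<noteq> b \<Longrightarrow> (a, b) \<in> E"
  defines "d' \<equiv> \<lambda>u v. if u = x then (if v = x then 0 else Suc (Min ((\<lambda>c. d c v) ` C)))
                     else if v = x then Suc (Min ((\<lambda>c. d c u) ` C)) else d u v"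
  shows "hop_metric (insert x V) (E \<union> {x} \<times> C \<union> C \<times> {x}) d'"
proof -
  have old: "d' u v = d u v" if "u \<in> V" "v \<in> V" for u v
    using that x by (auto simp: d'_def)
  have new: "d' x v = Suc (Min ((\<lambda>c. d c v) ` C))" "d' v x = Suc (Min ((\<lambda>c. d c v) ` C))"
    if "v \<in> V" for v using that x by (auto simp: d'_def)
  have xx: "d' x x = 0" by (simp add: d'_def)
  have Min_le: "Min ((\<lambda>c. d c v) ` C) \<le> d c v" if "c \<in> C" for c v
    using that C by simp
  have Min_ex: "\<exists>c\<in>C. Min ((\<lambda>c. d c v) ` C) = d c v" for v
    by (rule Min_image_witness[OF C(2,3), of "\<lambda>c. d c v"]) blast
  have near: "d c v \<le> Suc (d c' v)" if "c \<in> C" "c' \<in> C" "v \<in> V" for c c' v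
  proof (cases "c' = c")
    case False
    then show ?thesis
      using hop_metric_arc[OF d \<open>v \<in> V\<close> clique[OF that(2,1)]] hop_metric_sym[OF d \<open>v \<in> V\<close>] that C(1)
      by (metis subsetD)
  qed simp
  show ?thesis
    unfolding hop_metric_def
  proof (intro conjI ballI allI impI)
    fix u assume "u \<in> insert x V"
    then show "d' u u = 0" using old xx hop_metric_self[OF d] by auto
  next
    fix u v w
    assume u: "u \<in> insert x V" and vw: "(v, w) \<in> E \<union> {x} \<times> C \<union> C \<times> {x}"
    show "d' u w \<le> Suc (d' u v)"
    proof (cases "u = x")
      case True
      consider "(v, w) \<in> E" | "v = x" "w \<in> C" | "v \<in> C" "w = x" using vw by blast
      then show ?thesis
      proof cases
        case 1
        then have vw: "v \<in> V" "w \<in> V" using E by auto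
        obtain c where c: "c \<in> C" "Min ((\<lambda>c. d c v) ` C) = d c v" using Min_ex by blast
        have "d c w \<le> Suc (d c v)" using hop_metric_arc[OF d] 1 c C by blast
        then show ?thesis using Min_le[OF c(1), of w] c(2) True new vw by simp
      next
        case 2
        then have "w \<in> V" using C by blast
        then show ?thesis
          using True 2 new(1)[of w] xx Min_le[OF 2(2), of w] hop_metric_self[OF d, of w] by simp
      qed (use True xx in simp)
    next
      case False
      then have u: "u \<in> V" using u by blast
      consider "(v, w) \<in> E" | "v = x" "w \<in> C" | "v \<in> C" "w = x" using vw by blast
      then show ?thesis
      proof cases
        case 1
        then show ?thesis using old u E hop_metric_arc[OF d u 1] by auto
      next
        case 2
        obtain c where c: "c \<in> C" "Min ((\<lambda>c. d c u) ` C) = d c u" using Min_ex by blast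
        have "w \<in> V" using 2 C by blast
        then have "d u w = d w u" using hop_metric_sym[OF d u] by blast
        then show ?thesis
          using near[OF 2(2) c(1) u] c(2) new(2)[OF u] old[OF u \<open>w \<in> V\<close>] 2(1) by simp
      next
        case 3
        have "v \<in> V" using 3 C by blast
        then have "d u v = d v u" using hop_metric_sym[OF d u] by blast
        then show ?thesis
          using Min_le[OF 3(1), of u] new(2)[OF u] old[OF u \<open>v \<in> V\<close>] 3(2) by simp
      qed
    qed
  next
    fix u v
    assume u: "u \<in> insert x V" and v: "v \<in> insert x V" and "v \<noteq> u"
    let ?E = "E \<union> {x} \<times> C \<union> C \<times> {x}"
    show "\<exists>w\<in>insert x V. (w, v) \<in> ?E \<and> d' u v = Suc (d' u w)"
    proof (cases "u = x")
      case True
      then have v: "v \<in> V" using v \<open>v \<noteq> u\<close> by blast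
      obtain c where c: "c \<in> C" "Min ((\<lambda>c. d c v) ` C) = d c v" using Min_ex by blast
      show ?thesis
      proof (cases "v = c")
        case True
        then have "d' u v = Suc (d' u x)" "(x, v) \<in> ?E"
          using \<open>u = x\<close> c new(1)[OF v] xx hop_metric_self[OF d v] by simp_all
        then show ?thesis by blast
      next
        case False
        then obtain w where w: "w \<in> V" "(w, v) \<in> E" "d c v = Suc (d c w)"
          using hop_metric_pred[OF d, of c v] c(1) v C by blast
        \<comment> \<open>The member \<open>c\<close> nearest to \<open>v\<close> is also nearest to
          the predecessor \<open>w\<close>: a member nearer to \<open>w\<close> would be nearer to
          \<open>v\<close> as well.\<close>
        have "d c v \<le> Suc (Min ((\<lambda>c. d c w) ` C))"
        proof -
          obtain e where e: "e \<in> C" "Min ((\<lambda>c. d c w) ` C) = d e w" using Min_ex by blast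
          have "d e v \<le> Suc (d e w)" using hop_metric_arc[OF d] e(1) C w(2) by blast
          then show ?thesis using e(2) Min_le[OF e(1), of v] c(2) by simp
        qed
        then have "Min ((\<lambda>c. d c w) ` C) = d c w" using Min_le[OF c(1), of w] w(3) by simp
        then have "d' u v = Suc (d' u w)"
          using \<open>u = x\<close> c(2) w(3) new(1)[OF v] new(1)[OF w(1)] by simp
        then show ?thesis using w by blast
      qed
    next
      case False
      then have u: "u \<in> V" using u by blast
      show ?thesis
      proof (cases "v = x")
        case True
        obtain c where c: "c \<in> C" "Min ((\<lambda>c. d c u) ` C) = d c u" using Min_ex by blast
        then have "d u c = d c u" using hop_metric_sym[OF d u] C by blast
        moreover have "c \<in> V" using c C by blast
        ultimately have "d' u v = Suc (d' u c)" using True c(2) new(2)[OF u] old[OF u] by simp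
        then show ?thesis using True c(1) \<open>c \<in> V\<close> by blast
      next
        case False
        then have v: "v \<in> V" using v by blast
        then obtain w where w: "w \<in> V" "(w, v) \<in> E" "d u v = Suc (d u w)"
          using hop_metric_pred[OF d u v \<open>v \<noteq> u\<close>] by blast
        then have "d' u v = Suc (d' u w)" using old[OF u] v by simp
        then show ?thesis using w by blast
      qed
    qed
  next
    fix u v assume "u \<in> insert x V" "v \<in> insert x V"
    then show "d' u v = d' v u" using old new xx hop_metric_sym[OF d] by auto
  qed
qed

lemma hop_metric_Inl:
  assumes d: "hop_metric V E d"
  shows "hop_metric (Inl ` V) (map_prod Inl Inl ` E) (\<lambda>u v. d (projl u) (projl v))"
  unfolding hop_metric_def
proof (intro conjI ballI allI impI)
  fix u :: "'a + 'b" assume "u \<in> Inl ` V"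
  then obtain u' where u: "u = Inl u'" "u' \<in> V" by blast
  show "d (projl u) (projl u) = 0" using hop_metric_self[OF d] u by simp
  fix v w :: "'a + 'b" assume "(v, w) \<in> map_prod Inl Inl ` E"
  then show "d (projl u) (projl w) \<le> Suc (d (projl u) (projl v))"
    using hop_metric_arc[OF d u(2)] u(1) by force
next
  fix u v :: "'a + 'b" assume "u \<in> Inl ` V" "v \<in> Inl ` V" "v \<noteq> u"
  then obtain u' v' where u: "u = Inl u'" "u' \<in> V" and v: "v = Inl v'" "v' \<in> V" "v' \<noteq> u'" by blast
  obtain w where w: "w \<in> V" "(w, v') \<in> E" "d u' v' = Suc (d u' w)"
    using hop_metric_pred[OF d u(2) v(2,3)] by blast
  then have "(Inl w, v) \<in> map_prod Inl Inl ` E" using v(1) by force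
  then show "\<exists>w\<in>Inl ` V. (w, v) \<in> map_prod Inl Inl ` E \<and>
      d (projl u) (projl v) = Suc (d (projl u) (projl w))"
    using w u v by (intro bexI[of _ "Inl w"]) auto
next
  fix u v :: "'a + 'b" assume "u \<in> Inl ` V" "v \<in> Inl ` V"
  then show "d (projl u) (projl v) = d (projl v) (projl u)"
    using hop_metric_sym[OF d] by auto
qed

section \<open>Gluing a neighborhood sequence\<close>

lemma glue_vertex_simps [simp]:
  "glue_vertex v1 v2 (Suc 0) = Inl v1" "glue_vertex v1 v2 2 = Inl v2"
  "3 \<le> k \<Longrightarrow> glue_vertex v1 v2 k = Inr k"
  by (auto simp: glue_vertex_def)

text \<open>
  The entries of the distance matrix after the row and the column of \<open>a\<^sub>k\<close> have been subtracted
  from those of \<open>k\<close>, for every \<open>k \<ge> 3\<close>; the \<open>a\<^sub>k\<close> themselves no longer occur.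
\<close>

fun reduced_entry :: "(nat \<Rightarrow> nat) \<Rightarrow> ('a \<Rightarrow> 'a \<Rightarrow> nat) \<Rightarrow> 'a \<Rightarrow> 'a \<Rightarrow> 'a + nat \<Rightarrow> 'a + nat \<Rightarrow> real"
  where
  "reduced_entry b d0 v1 v2 (Inl u) (Inl v) = real (d0 u v)"
| "reduced_entry b d0 v1 v2 (Inr x) (Inl v) =
    (if b x = 2 then 1 + real (min (d0 v1 v) (d0 v2 v)) - real (d0 v1 v) else 1)"
| "reduced_entry b d0 v1 v2 (Inl v) (Inr x) =
    (if b x = 2 then 1 + real (min (d0 v1 v) (d0 v2 v)) - real (d0 v1 v) else 1)"
| "reduced_entry b d0 v1 v2 (Inr x) (Inr y) =
    (if x = y then -2 else if b (max x y) \<le> min x y then -1 else 0)"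

text \<open>The value \<open>b 2 = 2\<close> agrees with the formula k - q_k + 1 at k = 2, so
  monotonicity of \<open>b\<close> can start there.\<close>

locale glued_neighborhoods =
  fixes n :: nat and b a :: "nat \<Rightarrow> nat" and W :: "nat \<Rightarrow> nat set"
    and G0 :: "'a pair_pre_digraph" and d0 :: "'a \<Rightarrow> 'a \<Rightarrow> nat" and v1 v2 :: 'a
  assumes n: "2 \<le> n"
    and W1: "W (Suc 0) = {}" and W2: "W 2 = {Suc 0}" and b2: "b 2 = 2"
    and b_step: "k \<in> {3..n} \<Longrightarrow> b (k - 1) \<le> b k"
    and b_less: "k \<in> {3..n} \<Longrightarrow> b k < k"
    and a_prev: "k \<in> {3..n} \<Longrightarrow> a k \<in> W (k - 1)"
    and a_less: "k \<in> {3..n} \<Longrightarrow> a k < b k"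
    and W_eq: "k \<in> {3..n} \<Longrightarrow> W k = insert (a k) {b k..<k}"
    and G0: "pair_graph G0"
    and d0: "hop_metric (pverts G0) (parcs G0) d0"
    and e: "(v1, v2) \<in> parcs G0"
begin

abbreviation "\<gamma> \<equiv> glue_vertex v1 v2"

text \<open>Stage \<open>m\<close> glues only the part of the graph on 1, ..., m. Vertices 1 and 2
  are \<open>Inl v1\<close> and \<open>Inl v2\<close>, so stage 2 is \<open>G0\<close> itself, and
  each later stage adds one vertex.\<close>

definition V :: "nat \<Rightarrow> ('a + nat) set" where
  "V m = Inl ` pverts G0 \<union> Inr ` {3..m}"

definition E :: "nat \<Rightarrow> (('a + nat) \<times> ('a + nat)) set" where
  "E m = map_prod Inl Inl ` parcs G0 \<union>
  map_prod \<gamma> \<gamma> ` (\<Union>k\<in>{1..m}. \<Union>j\<in>W k. {(k, j), (j, k)})"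

section \<open>Combinatorics of the neighborhoods\<close>

lemma b_mono: "2 \<le> i \<Longrightarrow> i \<le> j \<Longrightarrow> j \<le> n \<Longrightarrow> b i \<le> b j"
proof (induction j)
  case (Suc j)
  show ?case
  proof (cases "i = Suc j")
    case False
    then have "b i \<le> b j" using Suc by simp
    also have "\<dots> \<le> b (Suc j)" using b_step[of "Suc j"] Suc.prems False by simp
    finally show ?thesis .
  qed simp
qed simp

lemma b_ge: "2 \<le> k \<Longrightarrow> k \<le> n \<Longrightarrow> 2 \<le> b k"
  using b_mono[of 2 k] b2 by simp

text \<open>Follows from the choice of \<open>a k\<close> in the preceding set and from
  \<open>b\<close> being nondecreasing. Iterating this inclusion makes the \<open>W k\<close>
  cliques.\<close>

lemma W_step: "k \<in> {3..n} \<Longrightarrow> W k \<subseteq> insert (k - 1) (W (k - 1))"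
proof
  fix j assume k: "k \<in> {3..n}" and j: "j \<in> W k"
  show "j \<in> insert (k - 1) (W (k - 1))"
  proof (cases "j = a k \<or> j = k - 1")
    case True
    then show ?thesis using a_prev[OF k] by auto
  next
    case False
    then have "b k \<le> j" "j < k - 1" using j k W_eq[OF k] by auto
    \<comment> \<open>\<open>W_eq\<close> does not cover \<open>W 2\<close>, but for
      \<open>k = 3\<close> the range \<open>b k \<le> j < k - 1\<close> is empty.\<close>
    moreover have "k \<noteq> 3" using calculation b_ge[of 3] k by auto
    ultimately have "k - 1 \<in> {3..n}" using k by auto
    then show ?thesis using W_eq \<open>b k \<le> j\<close> \<open>j < k - 1\<close> b_step[OF k] by auto
  qed
qed

lemma W_subset: "2 \<le> k \<Longrightarrow> k \<le> n \<Longrightarrow> W k \<subseteq> {1..<k}"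
proof (induction k)
  case (Suc k)
  show ?case
  proof (cases "Suc k = 2")
    case True
    then show ?thesis using W2 by (simp add: numeral_2_eq_2)
  next
    case False
    then have "W k \<subseteq> {1..<k}" "2 \<le> k" using Suc by simp_all
    then show ?thesis using W_step[of "Suc k"] Suc.prems by fastforce
  qed
qed simp

text \<open>Induction through \<open>W_step\<close>: of two members of \<open>W (Suc k)\<close>,
  either both lie in \<open>W k\<close>, or the larger is \<open>k\<close> and the smaller lies in
  \<open>W k\<close>.\<close>

lemma W_clique: "2 \<le> k \<Longrightarrow> k \<le> n \<Longrightarrow> i \<in> W k \<Longrightarrow> j \<in> W k \<Longrightarrow> i < j \<Longrightarrow> i \<in> W j"
proof (induction k)
  case (Suc k)
  show ?case
  proof (cases "Suc k = 2")
    case True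
    then show ?thesis using W2 Suc.prems by (simp add: numeral_2_eq_2)
  next
    case False
    then have k: "2 \<le> k" "Suc k \<in> {3..n}" using Suc.prems by simp_all
    have sub: "W (Suc k) \<subseteq> insert k (W k)" using W_step[OF k(2)] by simp
    have "j \<le> k" using W_subset[of "Suc k"] Suc.prems by auto
    then have "i \<in> W k" using sub Suc.prems by auto
    then show ?thesis using sub Suc k by (cases "j = k") auto
  qed
qed simp

lemma finite_W: "2 \<le> k \<Longrightarrow> k \<le> n \<Longrightarrow> finite (W k)"
  using W_subset finite_subset by blast

lemma W_nonempty: "2 \<le> k \<Longrightarrow> k \<le> n \<Longrightarrow> W k \<noteq> {}"
  using W2 W_eq[of k] by (cases "k = 2") auto

section \<open>Vertices and arcs of the stages\<close>

lemma e_in: "v1 \<in> pverts G0" "v2 \<in> pverts G0" "v1 \<noteq> v2" "(v2, v1) \<in> parcs G0"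
proof -
  interpret pair_graph G0 by (rule G0)
  show "v1 \<in> pverts G0" "v2 \<in> pverts G0" using e in_arcsD1 in_arcsD2 by auto
  show "v1 \<noteq> v2" using pair_no_loops[OF e] by simp
  show "(v2, v1) \<in> parcs G0" using pair_sym_arcs e by (auto simp: symmetric_def elim: symE)
qed

lemma \<gamma>_eq_iff: "1 \<le> i \<Longrightarrow> 1 \<le> j \<Longrightarrow> \<gamma> i = \<gamma> j \<longleftrightarrow> i = j"
  using e_in(3) by (auto simp: glue_vertex_def)

lemma \<gamma>_in_V: "1 \<le> k \<Longrightarrow> k \<le> max 2 m \<Longrightarrow> \<gamma> k \<in> V m"
  using e_in by (auto simp: glue_vertex_def V_def)

lemma V_mono: "i \<le> j \<Longrightarrow> V i \<subseteq> V j"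
  by (auto simp: V_def)

lemma arc_in_E: "i \<in> W k \<Longrightarrow> 1 \<le> k \<Longrightarrow> k \<le> m \<Longrightarrow> (\<gamma> i, \<gamma> k) \<in> E m \<and> (\<gamma> k, \<gamma> i) \<in> E m"
  unfolding E_def by (force simp: map_prod_def image_iff)

lemma E_subset: "2 \<le> m \<Longrightarrow> m \<le> n \<Longrightarrow> E m \<subseteq> V m \<times> V m"
proof -
  assume m: "2 \<le> m" "m \<le> n"
  interpret pair_graph G0 by (rule G0)
  have "\<gamma> k \<in> V m \<and> \<gamma> j \<in> V m" if "k \<in> {1..m}" "j \<in> W k" for k j
  proof -
    have "2 \<le> k" using that W1 by (cases "k = Suc 0") auto
    then show ?thesis using W_subset[of k] that m by (auto intro!: \<gamma>_in_V)
  qed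
  moreover have "map_prod Inl Inl ` parcs G0 \<subseteq> V m \<times> V m"
    using in_arcsD1 in_arcsD2 by (auto simp: V_def)
  ultimately show ?thesis unfolding E_def by auto
qed

text \<open>The edge {1, 2} is identified with the edge of \<open>G0\<close> and contributes nothing
  new.\<close>

lemma E_2: "E 2 = map_prod Inl Inl ` parcs G0"
proof -
  have "{1..2} = {Suc 0, 2}" by auto
  then show ?thesis using e e_in(4) by (auto simp: E_def W1 W2 image_iff)
qed

lemma E_Suc:
  assumes "2 \<le> m"
  shows "E (Suc m) = E m \<union> {Inr (Suc m)} \<times> \<gamma> ` W (Suc m) \<union> \<gamma> ` W (Suc m) \<times> {Inr (Suc m)}"
proof -
  have "{1..Suc m} = insert (Suc m) {1..m}" by auto
  moreover have "\<gamma> (Suc m) = Inr (Suc m)" using assms by simp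
  ultimately show ?thesis by (auto simp: E_def image_Un image_UN)
qed

text \<open>The case \<open>m = k - 1\<close> is included: the neighbors of \<open>k\<close> form a
  clique before \<open>k\<close> is added, as \<open>hop_metric_add_simplicial\<close>
  requires.\<close>

lemma clique_in_E:
  assumes k: "2 \<le> k" "k \<le> n" and m: "k \<le> Suc m" and ij: "i \<in> W k" "j \<in> W k" "i \<noteq> j"
  shows "(\<gamma> i, \<gamma> j) \<in> E m"
proof (cases "i < j")
  case True
  then show ?thesis using W_clique[OF k ij(1,2)] arc_in_E[of i j m] W_subset[OF k] ij m by auto
next
  case False
  then show ?thesis using W_clique[OF k ij(2,1)] arc_in_E[of j i m] W_subset[OF k] ij m by auto
qed

section \<open>Distances in the glued graph\<close>

text \<open>Later stages do not change old distances, so \<open>G0\<close> keeps \<open>d0\<close>,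
  and the recursion for \<open>x\<close> survives from the stage that adds \<open>x\<close>.\<close>

lemma ex_metric:
  assumes "2 \<le> m" "m \<le> n"
  shows "\<exists>d. hop_metric (V m) (E m) d \<and>
    (\<forall>u\<in>pverts G0. \<forall>v\<in>pverts G0. d (Inl u) (Inl v) = d0 u v) \<and>
    (\<forall>x\<in>{3..m}. \<forall>v\<in>V (x - 1). d (Inr x) v = Suc (Min ((\<lambda>w. d (\<gamma> w) v) ` W x)))"
  using assms
proof (induction m rule: nat_induct_at_least)
  case base
  let ?d = "\<lambda>u v. d0 (projl u) (projl v)"
  have "V 2 = Inl ` pverts G0" by (simp add: V_def)
  then have "hop_metric (V 2) (E 2) ?d"
    using hop_metric_Inl[OF d0] E_2 by simp
  then show ?case by (intro exI[of _ ?d]) simp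
next
  case (Suc m)
  then obtain d where d: "hop_metric (V m) (E m) d"
    and base: "\<And>u v. u \<in> pverts G0 \<Longrightarrow> v \<in> pverts G0 \<Longrightarrow> d (Inl u) (Inl v) = d0 u v"
    and rec: "\<And>x v. x \<in> {3..m} \<Longrightarrow> v \<in> V (x - 1) \<Longrightarrow>
      d (Inr x) v = Suc (Min ((\<lambda>w. d (\<gamma> w) v) ` W x))"
    by auto
  let ?x = "Inr (Suc m) :: 'a + nat" and ?C = "\<gamma> ` W (Suc m)"
  define d' where "d' = (\<lambda>u v. if u = ?x then (if v = ?x then 0 else Suc (Min ((\<lambda>c. d c v) ` ?C)))
                     else if v = ?x then Suc (Min ((\<lambda>c. d c u) ` ?C)) else d u v)"
  have notin: "?x \<notin> V m" by (auto simp: V_def)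
  have CV: "\<gamma> w \<in> V (k - 1)" if "w \<in> W k" "3 \<le> k" "k \<le> Suc m" for w k
  proof -
    have "w \<in> {1..<k}" using W_subset[of k] that Suc.prems by auto
    then show ?thesis by (intro \<gamma>_in_V) auto
  qed
  have "hop_metric (insert ?x (V m)) (E m \<union> {?x} \<times> ?C \<union> ?C \<times> {?x}) d'"
    unfolding d'_def
  proof (rule hop_metric_add_simplicial[OF d])
    show "E m \<subseteq> V m \<times> V m" using E_subset Suc by simp
    show "?x \<notin> V m" by (rule notin)
    show "?C \<subseteq> V m" using CV[of _ "Suc m"] Suc by auto
    show "finite ?C" "?C \<noteq> {}" using finite_W W_nonempty Suc by simp_all
    show "(c, c') \<in> E m" if "c \<in> ?C" "c' \<in> ?C" "c \<noteq> c'" for c c'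
      using that clique_in_E[of "Suc m" m] Suc by auto
  qed
  moreover have "insert ?x (V m) = V (Suc m)"
  proof -
    have "{3..Suc m} = insert (Suc m) {3..m}" using Suc by auto
    then show ?thesis by (auto simp: V_def)
  qed
  ultimately have "hop_metric (V (Suc m)) (E (Suc m)) d'" using E_Suc Suc by simp
  moreover have "d' (Inl u) (Inl v) = d0 u v" if "u \<in> pverts G0" "v \<in> pverts G0" for u v
    using base[OF that] by (simp add: d'_def)
  moreover have "d' (Inr x) v = Suc (Min ((\<lambda>w. d' (\<gamma> w) v) ` W x))"
    if x: "x \<in> {3..Suc m}" and v: "v \<in> V (x - 1)" for x v
  proof -
    have "x - 1 \<le> m" using x by auto
    then have "V (x - 1) \<subseteq> V m" by (rule V_mono)
    then have old: "u \<noteq> ?x" if "u \<in> V (x - 1)" for u using that notin by auto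
    \<comment> \<open>Both \<open>v\<close> and each \<open>\<gamma> w\<close> belong to stage
      \<open>x - 1\<close>, which lacks the new vertex, so \<open>d'\<close> and \<open>d\<close>
      agree on them.\<close>
    have "(\<lambda>w. d' (\<gamma> w) v) ` W x = (\<lambda>w. d (\<gamma> w) v) ` W x"
      using old[OF CV] old[OF v] x by (intro image_cong) (auto simp: d'_def)
    moreover have "d' (Inr x) v = Suc (Min ((\<lambda>w. d (\<gamma> w) v) ` W x))"
    proof (cases "x = Suc m")
      case True
      then show ?thesis using old[OF v] by (simp add: d'_def image_image)
    next
      case False
      then show ?thesis using rec[OF _ v] old[OF v] x by (simp add: d'_def)
    qed
    ultimately show ?thesis by simp
  qed
  ultimately show ?case by blast
qed

lemma pverts_edge_glue: "pverts (edge_glue G0 v1 v2 (nbhd_graph n W)) = V n"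
proof -
  have "{1..n} = insert (Suc 0) (insert 2 {3..n})" using n by auto
  moreover have "\<gamma> ` {3..n} = Inr ` {3..n}" by (intro image_cong) auto
  ultimately show ?thesis
    using e_in by (auto simp: edge_glue_def nbhd_graph_def V_def)
qed

lemma parcs_edge_glue: "parcs (edge_glue G0 v1 v2 (nbhd_graph n W)) = E n"
  by (simp add: edge_glue_def nbhd_graph_def E_def)

text \<open>
  Every \<open>j \<ge> b\<^sub>k\<close> in the clique \<open>W\<^sub>k\<close> has \<open>a\<^sub>k\<close> among its own earlier neighbors, so \<open>a\<^sub>k\<close> is at least
  as close as \<open>j\<close> to all vertices preceding \<open>j\<close>. For \<open>b\<^sub>k = 2\<close> this breaks down at \<open>j = 2\<close>, which may
  be closer to a vertex of \<open>G\<^sub>0\<close> than \<open>a\<^sub>k = 1\<close> is; but then there is no choice of \<open>a\<^sub>k\<close>.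
\<close>

lemma dist_eq_Suc_dist_a:
  assumes d: "hop_metric (V n) (E n) d"
    and rec: "\<forall>x\<in>{3..n}. \<forall>v\<in>V (x - 1).
      d (Inr x) v = Suc (Min ((\<lambda>w. d (\<gamma> w) v) ` W x))"
    and x: "x \<in> {3..n}" and b: "3 \<le> b x" and v: "v \<in> V (b x - 1)"
  shows "d (Inr x) v = Suc (d (\<gamma> (a x)) v)"
proof -
  have aW: "a x \<in> W x" using W_eq[OF x] by simp
  have "b x - 1 \<le> x - 1" using b_less[OF x] by simp
  then have "v \<in> V (x - 1)" using V_mono v by blast
  then have "d (Inr x) v = Suc (Min ((\<lambda>w. d (\<gamma> w) v) ` W x))" by (rule rec[rule_format, OF x])
  also have "Min ((\<lambda>w. d (\<gamma> w) v) ` W x) = d (\<gamma> (a x)) v"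
  proof (rule Min_eqI)
    show "finite ((\<lambda>w. d (\<gamma> w) v) ` W x)" using finite_W x by simp
    show "d (\<gamma> (a x)) v \<in> (\<lambda>w. d (\<gamma> w) v) ` W x" using aW by blast
    fix r assume "r \<in> (\<lambda>w. d (\<gamma> w) v) ` W x"
    then obtain j where j: "j \<in> W x" "r = d (\<gamma> j) v" by blast
    show "d (\<gamma> (a x)) v \<le> r"
    proof (cases "j = a x")
      case False
      then have bj: "b x \<le> j" "j < x" using j W_eq[OF x] by auto
      then have j': "j \<in> {3..n}" using x b by auto
      have "a x < j" using a_less[OF x] bj by simp
      then have aj: "a x \<in> W j" using W_clique[OF _ _ aW j(1)] x by simp
      have "b x - 1 \<le> j - 1" "j - 1 \<le> n" using bj j' by auto
      then have vj: "v \<in> V (j - 1)" and vn: "v \<in> V n" using V_mono v by blast+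
      have "finite (W j)" "W j \<noteq> {}" using finite_W W_nonempty j' by auto
      then obtain w where w: "w \<in> W j" "Min ((\<lambda>w. d (\<gamma> w) v) ` W j) = d (\<gamma> w) v"
        by (rule Min_image_witness)
      \<comment> \<open>The vertex \<open>j\<close> is one step behind some \<open>w\<close> in the
        clique \<open>W j\<close>; since \<open>a x\<close> is also in \<open>W j\<close>, it equals
        \<open>w\<close> or is adjacent to it.\<close>
      have r: "r = Suc (d (\<gamma> w) v)" using rec[rule_format, OF j' vj] w(2) j(2) j' by simp
      have in_V: "\<gamma> i \<in> V n" if "i \<in> W j" for i
        using W_subset[of j] j' that by (auto intro!: \<gamma>_in_V)
      have "d v (\<gamma> (a x)) \<le> Suc (d v (\<gamma> w))"
      proof (cases "w = a x")
        case False
        then have "(\<gamma> w, \<gamma> (a x)) \<in> E n" using clique_in_E[of j n w "a x"] w(1) aj j' by simp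
        then show ?thesis by (rule hop_metric_arc[OF d vn])
      qed simp
      then show ?thesis using r hop_metric_sym[OF d vn] in_V w(1) aj by simp
    qed (use j in simp)
  qed
  finally show ?thesis .
qed

text \<open>Here \<open>W x\<close> consists of 1, ..., x - 1. By monotonicity
  \<open>b j = 2\<close> for every \<open>j\<close> from 3 to x - 1, so by induction such
  \<open>j\<close> are farther from \<open>v\<close> than the nearer of 1 and 2.\<close>

lemma dist_eq_Suc_min:
  assumes rec: "\<forall>x\<in>{3..n}. \<forall>v\<in>V (x - 1).
      d (Inr x) v = Suc (Min ((\<lambda>w. d (\<gamma> w) v) ` W x))"
    and v: "v \<in> V 2" and "x \<in> {3..n}" "b x = 2"
  shows "d (Inr x) v = Suc (min (d (Inl v1) v) (d (Inl v2) v))"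
  using assms(3-)
proof (induction x rule: less_induct)
  case (less x)
  note x = less.prems(1)
  have "1 \<le> a x" using a_prev[OF x] W_subset[of "x - 1"] x by fastforce
  then have "a x = Suc 0" using a_less[OF x] less.prems by simp
  moreover have "{2..<x} = insert 2 {3..<x}" using x by auto
  ultimately have W: "W x = insert (Suc 0) (insert 2 {3..<x})" using W_eq[OF x] less.prems by simp
  have "2 \<le> x - 1" using x by auto
  then have "v \<in> V (x - 1)" using V_mono v by blast
  then have "d (Inr x) v = Suc (Min ((\<lambda>w. d (\<gamma> w) v) ` W x))" by (rule rec[rule_format, OF x])
  also have "Min ((\<lambda>w. d (\<gamma> w) v) ` W x) = min (d (Inl v1) v) (d (Inl v2) v)"
  proof (rule Min_eqI)
    show "finite ((\<lambda>w. d (\<gamma> w) v) ` W x)" using W by simp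
    show "min (d (Inl v1) v) (d (Inl v2) v) \<in> (\<lambda>w. d (\<gamma> w) v) ` W x"
      using W by (simp add: min_def)
    fix r assume "r \<in> (\<lambda>w. d (\<gamma> w) v) ` W x"
    then obtain j where j: "j \<in> W x" "r = d (\<gamma> j) v" by blast
    then consider "j = Suc 0" | "j = 2" | "j \<in> {3..<x}" using W by auto
    then show "min (d (Inl v1) v) (d (Inl v2) v) \<le> r"
    proof cases
      case 3
      then have "b j = 2" using b_ge[of j] b_mono[of j x] less.prems by simp
      then have "d (Inr j) v = Suc (min (d (Inl v1) v) (d (Inl v2) v))"
        using less.IH[of j] 3 x by simp
      then show ?thesis using j 3 by simp
    qed (use j in auto)
  qed
  finally show ?case .
qed

section \<open>The reduced determinant\<close>

text \<open>Listing \<open>G0\<close> first and then 3, ..., n places the vertex of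
  \<open>a k\<close> before that of \<open>k\<close>, so the subtraction lemma applies.\<close>

lemma det_edge_glue:
  assumes vs: "vertex_ordering (edge_glue G0 v1 v2 (nbhd_graph n W)) vs"
    and L: "distinct L" "set L = pverts G0"
  defines "us \<equiv> map Inl L @ map Inr [3..<Suc n]"
  shows "det (distance_matrix (edge_glue G0 v1 v2 (nbhd_graph n W)) vs) =
    det (mat (length us) (length us) (\<lambda>(i, j). reduced_entry b d0 v1 v2 (us ! i) (us ! j)))"
proof -
  let ?G = "edge_glue G0 v1 v2 (nbhd_graph n W)"
  obtain d where d: "hop_metric (V n) (E n) d"
    and base: "\<And>u v. u \<in> pverts G0 \<Longrightarrow> v \<in> pverts G0 \<Longrightarrow> d (Inl u) (Inl v) = d0 u v"
    and rec: "\<forall>x\<in>{3..n}. \<forall>v\<in>V (x - 1).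
      d (Inr x) v = Suc (Min ((\<lambda>w. d (\<gamma> w) v) ` W x))"
    using ex_metric[of n] n by blast
  have "pair_wf_digraph ?G"
    by unfold_locales (use E_subset[of n] n in \<open>auto simp: pverts_edge_glue parcs_edge_glue\<close>)
  then have dist: "graph_dist ?G u v = real (d u v)" if "u \<in> V n" "v \<in> V n" for u v
    using graph_dist_hop_metric[of ?G d u v] d that
    by (simp add: pverts_edge_glue parcs_edge_glue)
  have set_us: "set us = V n" using L by (auto simp: us_def V_def)
  have vs': "distinct vs" "set vs = V n"
    using vs by (auto simp: vertex_ordering_def pverts_edge_glue)
  have us_V: "us ! i \<in> V n" if "i < length us" for i using that set_us nth_mem by blast
  let ?f = "\<lambda>u v. real (d u v)" and ?I = "range Inr :: ('a + nat) set"
  define p where "p u = \<gamma> (a (projr u))" for u :: "'a + nat"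
  have p: "p (Inr x) = \<gamma> (a x)" for x by (simp add: p_def)
  have a_pos: "1 \<le> a x" if "x \<in> {3..n}" for x
    using a_prev[OF that] W_subset[of "x - 1"] that by fastforce
  have sym: "d u v = d v u" if "u \<in> V n" "v \<in> V n" for u v
    using hop_metric_sym[OF d] that by blast
  have \<gamma>V: "\<gamma> k \<in> V n" if "1 \<le> k" "k \<le> n" for k using that by (auto intro!: \<gamma>_in_V)
  have aV: "\<gamma> (a x) \<in> V n" if "x \<in> {3..n}" for x
    using \<gamma>V[OF a_pos[OF that]] a_less[OF that] b_less[OF that] that by simp
  have to_G0: "?f (Inr x) (Inl v) - ?f (\<gamma> (a x)) (Inl v) = reduced_entry b d0 v1 v2 (Inr x) (Inl v)"
    if x: "x \<in> {3..n}" and v: "v \<in> pverts G0" for x v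
  proof (cases "b x = 2")
    case True
    then have "a x = Suc 0" using a_pos[OF x] a_less[OF x] by simp
    moreover have "Inl v \<in> V 2" using v by (simp add: V_def)
    ultimately show ?thesis
      using dist_eq_Suc_min[OF rec _ x True] True base e_in v by simp
  next
    case False
    then have "3 \<le> b x" using b_ge[of x] x by simp
    moreover have "Inl v \<in> V (b x - 1)" using v by (simp add: V_def)
    ultimately show ?thesis using dist_eq_Suc_dist_a[OF d rec x] False by simp
  qed
  have to_prev: "?f (Inr x) (\<gamma> k) - ?f (\<gamma> (a x)) (\<gamma> k) = (if b x \<le> k then 0 else 1)"
    if x: "x \<in> {3..n}" and k: "1 \<le> k" "k < x" for x k
  proof -
    have xV: "Inr x \<in> V n" using x by (simp add: V_def)
    have kV: "\<gamma> k \<in> V n" using \<gamma>V k x by simp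
    have adj: "d (Inr x) (\<gamma> j) = 1" if "j \<in> W x" for j
    proof (rule hop_metric_adjacent[OF d])
      have j: "1 \<le> j" "j < x" using W_subset[of x] that x by auto
      show "(Inr x, \<gamma> j) \<in> E n" using arc_in_E[OF that, of n] x by simp
      show "Inr x \<noteq> \<gamma> j" using \<gamma>_eq_iff[of x j] j x by simp
      show "\<gamma> j \<in> V n" using \<gamma>V j x by simp
    qed (rule xV)
    have aW: "a x \<in> W x" using W_eq[OF x] by simp
    \<comment> \<open>The differences are 1 - 1 and 1 - 0 for \<open>k\<close> in
      \<open>W x\<close>; otherwise \<open>a x\<close> is one step closer to \<open>k\<close> than
      \<open>x\<close> is.\<close>
    consider "b x \<le> k" | "k = a x" | "k < b x" "k \<noteq> a x" by linarith
    then show ?thesis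
    proof cases
      case 1
      then have kW: "k \<in> W x" and "k \<noteq> a x" using W_eq[OF x] k a_less[OF x] by auto
      have "d (\<gamma> (a x)) (\<gamma> k) = 1"
      proof (rule hop_metric_adjacent[OF d _ aV[OF x] kV])
        show "(\<gamma> (a x), \<gamma> k) \<in> E n"
          using clique_in_E[of x n "a x" k] aW kW \<open>k \<noteq> a x\<close> x by simp
        show "\<gamma> (a x) \<noteq> \<gamma> k" using \<gamma>_eq_iff[OF a_pos[OF x] k(1)] \<open>k \<noteq> a x\<close> by simp
      qed
      then show ?thesis using adj[OF kW] 1 by simp
    next
      case 2
      then show ?thesis
        using adj[OF aW] a_less[OF x] hop_metric_self[OF d aV[OF x]] by simp
    next
      case 3
      \<comment> \<open>If \<open>b x\<close> were 2, both \<open>k\<close> and \<open>a x\<close>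
        would be 1.\<close>
      then have "3 \<le> b x" using b_ge[of x] a_less[OF x] a_pos[OF x] x k by linarith
      moreover have "\<gamma> k \<in> V (b x - 1)" using 3 k by (auto intro!: \<gamma>_in_V)
      ultimately show ?thesis using dist_eq_Suc_dist_a[OF d rec x] 3 by simp
    qed
  qed
  have reduced_below: "(?f (Inr x) (Inr y) - ?f (p (Inr x)) (Inr y)) -
      (?f (Inr x) (p (Inr y)) - ?f (p (Inr x)) (p (Inr y))) = reduced_entry b d0 v1 v2 (Inr x) (Inr y)"
    if x: "x \<in> {3..n}" and y: "y \<in> {3..n}" and "y \<le> x" for x y
  proof (cases "y = x")
    case True
    have xV: "Inr x \<in> V n" using x by (simp add: V_def)
    \<comment> \<open>The diagonal entry is (0 - 1) - (1 - 0) = -2.\<close>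
    have "d (Inr x) (\<gamma> (a x)) - d (\<gamma> (a x)) (\<gamma> (a x)) = 1"
      using to_prev[OF x a_pos[OF x]] a_less[OF x] b_less[OF x] hop_metric_self[OF d aV[OF x]] by simp
    then show ?thesis
      using True sym[OF xV aV[OF x]] hop_metric_self[OF d aV[OF x]] hop_metric_self[OF d xV]
      by (simp add: p)
  next
    case False
    then have "y < x" using \<open>y \<le> x\<close> by simp
    \<comment> \<open>Since \<open>a y < b y \<le> b x\<close>, column \<open>a y\<close> always
      holds 1, while column \<open>y\<close> holds 0 or 1 according to whether
      \<open>b x \<le> y\<close>. The choice of \<open>a y\<close> thus drops out.\<close>
    have "a y < b x" "a y < x"
      using a_less[OF y] b_mono[of y x] b_less[OF x] x y \<open>y < x\<close> by auto
    then show ?thesis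
      using to_prev[OF x, of y] to_prev[OF x a_pos[OF y]] \<open>y < x\<close> y by (simp add: p)
  qed
  have reduced_Inr: "(?f (Inr x) (Inr y) - ?f (p (Inr x)) (Inr y)) -
      (?f (Inr x) (p (Inr y)) - ?f (p (Inr x)) (p (Inr y))) = reduced_entry b d0 v1 v2 (Inr x) (Inr y)"
    if x: "x \<in> {3..n}" and y: "y \<in> {3..n}" for x y
  proof (cases "y \<le> x")
    case True
    with x y show ?thesis by (rule reduced_below)
  next
    case False
    then have "(?f (Inr y) (Inr x) - ?f (p (Inr y)) (Inr x)) -
      (?f (Inr y) (p (Inr x)) - ?f (p (Inr y)) (p (Inr x))) = reduced_entry b d0 v1 v2 (Inr y) (Inr x)"
      using reduced_below[OF y x] by simp
    moreover have "Inr x \<in> V n" "Inr y \<in> V n" using x y by (simp_all add: V_def)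
    moreover have "reduced_entry b d0 v1 v2 (Inr y) (Inr x) = reduced_entry b d0 v1 v2 (Inr x) (Inr y)"
      by (simp add: max.commute min.commute)
    ultimately show ?thesis
      using sym[of "Inr x" "Inr y"] sym[OF _ aV[OF y], of "Inr x"] sym[OF _ aV[OF x], of "Inr y"]
        sym[OF aV[OF x] aV[OF y]] by (simp add: p del: reduced_entry.simps)
  qed
  have reduced: "(?f u v - (if u \<in> ?I then ?f (p u) v else 0)) -
      (if v \<in> ?I then ?f u (p v) - (if u \<in> ?I then ?f (p u) (p v) else 0) else 0) =
      reduced_entry b d0 v1 v2 u v"
    if uv: "u \<in> V n" "v \<in> V n" for u v
  proof -
    consider u' v' where "u = Inl u'" "v = Inl v'" "u' \<in> pverts G0" "v' \<in> pverts G0"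
      | x v' where "u = Inr x" "v = Inl v'" "x \<in> {3..n}" "v' \<in> pverts G0"
      | u' y where "u = Inl u'" "v = Inr y" "u' \<in> pverts G0" "y \<in> {3..n}"
      | x y where "u = Inr x" "v = Inr y" "x \<in> {3..n}" "y \<in> {3..n}"
      using uv unfolding V_def by blast
    then show ?thesis
    proof cases
      case 1
      then show ?thesis using base by (simp add: image_iff)
    next
      case 2
      then show ?thesis using to_G0[of x v'] by (simp add: p image_iff)
    next
      case 3
      then show ?thesis
        using to_G0[of y u'] sym[OF uv] sym[OF uv(1) aV[of y]] by (simp add: p image_iff)
    next
      case 4
      then show ?thesis using reduced_Inr[of x y] by simp
    qed
  qed
  have "distance_matrix ?G vs = mat (length vs) (length vs) (\<lambda>(i, j). ?f (vs ! i) (vs ! j))"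
    unfolding distance_matrix_def
    by (rule cong_mat) (use vs' in \<open>auto intro!: dist simp flip: vs'(2)\<close>)
  also have "det \<dots> = det (mat (length us) (length us) (\<lambda>(i, j). ?f (us ! i) (us ! j)))"
    by (rule det_reindex) (use vs' set_us L in \<open>auto simp: us_def distinct_map\<close>)
  also have "\<dots> = det (mat (length us) (length us) (\<lambda>(i, j).
      (?f (us ! i) (us ! j) - (if us ! i \<in> ?I then ?f (p (us ! i)) (us ! j) else 0)) -
      (if us ! j \<in> ?I then
        ?f (us ! i) (p (us ! j)) - (if us ! i \<in> ?I then ?f (p (us ! i)) (p (us ! j)) else 0)
       else 0)))"
  proof (rule det_subtract_previous_rows_cols)
    fix i assume i: "i < length us" "us ! i \<in> ?I"
    then have iL: "length L \<le> i" by (auto simp: us_def nth_append split: if_splits)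
    \<comment> \<open>Vertex \<open>Inr x\<close> stands at position
      \<open>length L + (x - 3)\<close>; if \<open>a x\<close> is 1 or 2, its row is found among
      those of \<open>G0\<close> instead.\<close>
    define x where "x = 3 + (i - length L)"
    have x: "us ! i = Inr x" "x \<in> {3..n}"
      using i iL by (auto simp: us_def x_def nth_append simp del: upt_Suc)
    have ax: "1 \<le> a x" "a x < x" using a_pos[OF x(2)] a_less[OF x(2)] b_less[OF x(2)] by auto
    show "\<exists>j<i. us ! j = p (us ! i)"
    proof (cases "3 \<le> a x")
      case True
      then have "us ! (length L + (a x - 3)) = Inr (a x)"
        using ax x by (simp add: us_def nth_append del: upt_Suc)
      moreover have "length L + (a x - 3) < i" using True ax iL by (simp add: x_def)
      ultimately show ?thesis using True x(1) p by (intro exI[of _ "length L + (a x - 3)"]) simp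
    next
      case False
      then have "p (us ! i) \<in> Inl ` set L"
        using ax x(1) e_in L by (auto simp: p glue_vertex_def)
      then obtain j where "j < length L" "p (us ! i) = Inl (L ! j)"
        by (auto simp: in_set_conv_nth)
      then show ?thesis using iL by (intro exI[of _ j]) (simp add: us_def nth_append)
    qed
  qed
  also have "\<dots> = det (mat (length us) (length us) (\<lambda>(i, j). reduced_entry b d0 v1 v2 (us ! i) (us ! j)))"
    by (intro arg_cong[where f = det] cong_mat refl) (simp only: prod.case reduced[OF us_V us_V])
  finally show ?thesis .
qed

end

text \<open>The right-hand side involves neither \<open>G\<close> nor \<open>vs\<close>, which is
  the independence sought.\<close>

lemma det_edge_glue_CP:
  assumes nl: "non_leaping n q" and G0: "pair_graph G0"
    and d0: "hop_metric (pverts G0) (parcs G0) d0" and e: "(v1, v2) \<in> parcs G0"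
    and G: "G \<in> CP n q" and vs: "vertex_ordering (edge_glue G0 v1 v2 G) vs"
    and L: "distinct L" "set L = pverts G0"
  defines "us \<equiv> map Inl L @ map Inr [3..<Suc n]"
  shows "det (distance_matrix (edge_glue G0 v1 v2 G) vs) =
    det (mat (length us) (length us)
      (\<lambda>(i, j). reduced_entry (\<lambda>k. nat (nbhd_start q k)) d0 v1 v2 (us ! i) (us ! j)))"
proof -
  \<comment> \<open>For \<open>k\<close> in \<open>{3..n}\<close> no truncation occurs:
    \<open>nbhd_start q k\<close> exceeds the natural number \<open>a k\<close>.\<close>
  let ?b = "\<lambda>k. nat (nbhd_start q k)"
  obtain W where W: "nbhd_seq n q W" and G_eq: "G = nbhd_graph n W" using G by (auto simp: CP_def)
  have "\<forall>k\<in>{3..n}. \<exists>a\<in>W (k - 1). int a < nbhd_start q k \<and>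
      W k = {a} \<union> {j. nbhd_start q k \<le> int j \<and> j \<le> k - 1}"
    using W by (simp add: nbhd_seq_def)
  then obtain a where a: "\<And>k. k \<in> {3..n} \<Longrightarrow> a k \<in> W (k - 1)"
      "\<And>k. k \<in> {3..n} \<Longrightarrow> int (a k) < nbhd_start q k"
      "\<And>k. k \<in> {3..n} \<Longrightarrow> W k = {a k} \<union> {j. nbhd_start q k \<le> int j \<and> j \<le> k - 1}"
    by metis
  have q: "2 \<le> q k" "q k \<le> q (k - 1) + 1" if "k \<in> {3..n}" for k
    using nl that by (auto simp: non_leaping_def)
  interpret glued_neighborhoods n ?b a W G0 d0 v1 v2
  proof (rule glued_neighborhoods.intro)
    show "2 \<le> n" "?b 2 = 2" using nl by (auto simp: non_leaping_def nbhd_start_def)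
    show "W (Suc 0) = {}" "W 2 = {Suc 0}" using W by (auto simp: nbhd_seq_def)
    fix k assume k: "k \<in> {3..n}"
    \<comment> \<open>The non-leaping bound \<open>q k \<le> q (k - 1) + 1\<close> says exactly that
      \<open>nbhd_start q\<close> does not decrease.\<close>
    show "?b (k - 1) \<le> ?b k" using q[OF k] k by (simp add: nbhd_start_def)
    show "?b k < k" using q[OF k] k by (auto simp: nbhd_start_def)
    show "a k \<in> W (k - 1)" by (rule a(1)[OF k])
    show "a k < ?b k" using a(2)[OF k] by simp
    have "j \<in> {j. nbhd_start q k \<le> int j \<and> j \<le> k - 1} \<longleftrightarrow> j \<in> {?b k..<k}" for j
      using k by (simp add: nat_le_iff) linarith
    then show "W k = insert (a k) {?b k..<k}" unfolding a(3)[OF k] by blast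
  qed (rule G0 d0 e)+
  show ?thesis using det_edge_glue[of vs L] vs L by (simp add: G_eq us_def)
qed

theorem theorem3p5:
  fixes n :: nat and q :: "nat \<Rightarrow> int"
    and G0 :: "'a pair_pre_digraph" and v1 v2 :: 'a
    and G G' :: "nat pair_pre_digraph"
    and vs vs' :: "('a + nat) list"
  assumes "non_leaping n q"
    and "pair_graph G0"
    and "Digraph_Component.connected (with_proj G0)"
    and "(v1, v2) \<in> parcs G0"
    and "G \<in> CP n q"
    and "G' \<in> CP n q"
    and "vertex_ordering (edge_glue G0 v1 v2 G) vs"
    and "vertex_ordering (edge_glue G0 v1 v2 G') vs'"
  shows "det (distance_matrix (edge_glue G0 v1 v2 G) vs) =
         det (distance_matrix (edge_glue G0 v1 v2 G') vs')"
proof -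
  interpret pair_graph G0 by (rule assms(2))
  obtain d0 where d0: "hop_metric (pverts G0) (parcs G0) d0"
    using connected_graph_hop_metric[OF assms(2,3)] .
  obtain L where L: "distinct L" "set L = pverts G0"
    using finite_distinct_list[OF pair_finite_verts] by blast
  \<comment> \<open>Since \<open>d0\<close> and \<open>L\<close> come from \<open>G0\<close> alone,
    both determinants equal the same reduced one.\<close>
  show ?thesis
    using det_edge_glue_CP[OF assms(1,2) d0 assms(4,5,7) L]
      det_edge_glue_CP[OF assms(1,2) d0 assms(4,6,8) L] by simp
qed

end
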